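(* Let $\varrho:[a,b]\to\mathbb{C}$ be an integrable density function and consider the functional $I_\varrho: H^1_0([a,b])\to\mathbb{C}$, $I_\varrho(f)=\int_a^b f(x)\varrho(x)\,dx$. Then $$e_0=\sup_{\|f\|\le 1}|I_\varrho(f)| = \|R-c\|_{2},$$ where the supremum is over $f\in H^1_0([a,b])$, $R(t)=\int_a^t \varrho(x)\,dx$ for $t\in[a,b]$, and $c=\frac{1}{b-a}\int_a^b R(x)\,dx$. Moreover, the maximum is assumed for $f^*\in H^1_0([a,b])$, given by $$f^*(t)=-\int_a^t \frac{\overline{R(x)}-\overline{c}}{\|R-c\|_2}\,dx,$$ i.e., $I_\varrho(f^* )=\|R-c\|_2$ and $\|f^*\|=1$ with $f^*(a)=f^*(b)=0$.
   Context: Here $a<b$ are real numbers. $H^1_0([a,b])$ is the space of all absolutely continuous functions $f:[a,b]\to\mathbb{C}$ with $f'\in L_2([a,b])$ and $f(a)=f(b)=0$, with norm $\|f\|:=\|f'\|_{L_2([a,b])}$. $\|\cdot\|_2$ denotes the norm of $L_2([a,b])$. The number $e_0$ is called the initial error. *)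

theory Defs
  imports "HOL-Analysis.Analysis"
begin

(* Functions on [a,b] are total functions on the reals; every notion below depends
   only on their values on {a..b}. *)

definition abs_continuous_on :: "real \<Rightarrow> real \<Rightarrow> (real \<Rightarrow> complex) \<Rightarrow> bool" where
  "abs_continuous_on a b f \<longleftrightarrow>
     (\<forall>\<epsilon>>0. \<exists>\<delta>>0. \<forall>n (l :: nat \<Rightarrow> real) u.
        (\<forall>i<n. a \<le> l i \<and> l i \<le> u i \<and> u i \<le> b) \<longrightarrow>
        disjoint_family_on (\<lambda>i. {l i<..<u i}) {..<n} \<longrightarrow>
        (\<Sum>i<n. u i - l i) < \<delta> \<longrightarrow>
        (\<Sum>i<n. dist (f (l i)) (f (u i))) < \<epsilon>)"

definition L2 :: "real \<Rightarrow> real \<Rightarrow> (real \<Rightarrow> complex) set" where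
  "L2 a b = {g. g \<in> borel_measurable (lebesgue_on {a..b}) \<and>
                integrable (lebesgue_on {a..b}) (\<lambda>x. (cmod (g x))\<^sup>2)}"

definition L2_norm :: "real \<Rightarrow> real \<Rightarrow> (real \<Rightarrow> complex) \<Rightarrow> real" where
  "L2_norm a b g = sqrt (LINT x|lebesgue_on {a..b}. (cmod (g x))\<^sup>2)"

definition derivative_on :: "real \<Rightarrow> real \<Rightarrow> (real \<Rightarrow> complex) \<Rightarrow> real \<Rightarrow> complex" where
  "derivative_on a b f x = vector_derivative f (at x within {a..b})"

(* The vector derivative has an arbitrary value at points of non-differentiability, so
   the assertion that the derivative lies in L2 includes its existence almost everywhere
   (which absolute continuity implies). *)
definition H10 :: "real \<Rightarrow> real \<Rightarrow> (real \<Rightarrow> complex) set" where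
  "H10 a b = {f. abs_continuous_on a b f \<and>
                 (AE x in lebesgue_on {a..b}. f differentiable (at x within {a..b})) \<and>
                 derivative_on a b f \<in> L2 a b \<and> f a = 0 \<and> f b = 0}"

definition H10_norm :: "real \<Rightarrow> real \<Rightarrow> (real \<Rightarrow> complex) \<Rightarrow> real" where
  "H10_norm a b f = L2_norm a b (derivative_on a b f)"

definition density_integral ::
    "real \<Rightarrow> real \<Rightarrow> (real \<Rightarrow> complex) \<Rightarrow> (real \<Rightarrow> complex) \<Rightarrow> complex" where
  "density_integral a b \<rho> f = (LINT x|lebesgue_on {a..b}. f x * \<rho> x)"

(* Taken in the extended reals, so that the supremum is meaningful without
   knowing beforehand that the functional is bounded. *)
definition initial_error :: "real \<Rightarrow> real \<Rightarrow> (real \<Rightarrow> complex) \<Rightarrow> ereal" where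
  "initial_error a b \<rho> =
     (SUP f \<in> {f \<in> H10 a b. H10_norm a b f \<le> 1}. ereal (cmod (density_integral a b \<rho> f)))"

definition primitive :: "real \<Rightarrow> (real \<Rightarrow> complex) \<Rightarrow> real \<Rightarrow> complex" where
  "primitive a g t = (LINT x|lebesgue_on {a..t}. g x)"

definition mean_value :: "real \<Rightarrow> real \<Rightarrow> (real \<Rightarrow> complex) \<Rightarrow> complex" where
  "mean_value a b g = (LINT x|lebesgue_on {a..b}. g x) / complex_of_real (b - a)"

end

(* Every f in H10 is the primitive of its derivative f' (fundamental theorem of calculus for
   absolutely continuous functions), so Fubini and f(b) = 0 give
   I(f) = - the integral of f' (R - c), for any constant c.  Cauchy-Schwarz bounds this by
   ||f'|| ||R - c||, with equality for f' proportional to the conjugate of R - c; the mean value c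
   is the constant for which this choice integrates to zero, i.e. for which f(b) = 0. *)

theory Submission
  imports Defs
begin

section \<open>Absolute continuity and the fundamental theorem of calculus\<close>

lemma abs_continuous_on_subinterval:
  assumes "abs_continuous_on a b f" "a \<le> a'" "b' \<le> b"
  shows "abs_continuous_on a' b' f"
  unfolding abs_continuous_on_def
proof (intro allI impI)
  fix e :: real assume "e > 0"
  with assms(1) obtain d where d: "d > 0" "\<And>n (l :: nat \<Rightarrow> real) u.
        (\<forall>i<n. a \<le> l i \<and> l i \<le> u i \<and> u i \<le> b) \<Longrightarrow>
        disjoint_family_on (\<lambda>i. {l i<..<u i}) {..<n} \<Longrightarrow>
        (\<Sum>i<n. u i - l i) < d \<Longrightarrow> (\<Sum>i<n. dist (f (l i)) (f (u i))) < e"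
    unfolding abs_continuous_on_def by meson
  show "\<exists>\<delta>>0. \<forall>n (l :: nat \<Rightarrow> real) u.
        (\<forall>i<n. a' \<le> l i \<and> l i \<le> u i \<and> u i \<le> b') \<longrightarrow>
        disjoint_family_on (\<lambda>i. {l i<..<u i}) {..<n} \<longrightarrow>
        (\<Sum>i<n. u i - l i) < \<delta> \<longrightarrow> (\<Sum>i<n. dist (f (l i)) (f (u i))) < e"
    using d assms(2,3) by (intro exI[of _ d] conjI allI impI) (auto intro!: d(2) dest: order_trans)
qed

text \<open>The definition numbers its intervals by \<open>{..<n}\<close>; a bijection with
  \<open>{..<card p}\<close> transports it to any finite index set. This is needed because Riemann
  sums are indexed by pairs of a tag and an interval.\<close>

lemma abs_continuous_on_finite_family:
  fixes f :: "real \<Rightarrow> complex"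
  assumes "abs_continuous_on a b f" "0 < e"
  shows "\<exists>d>0. \<forall>p (l :: 'i \<Rightarrow> real) u. finite p \<longrightarrow> (\<forall>i\<in>p. a \<le> l i \<and> l i \<le> u i \<and> u i \<le> b) \<longrightarrow>
    disjoint_family_on (\<lambda>i. {l i<..<u i}) p \<longrightarrow> (\<Sum>i\<in>p. u i - l i) < d \<longrightarrow>
    (\<Sum>i\<in>p. dist (f (l i)) (f (u i))) < e"
proof -
  from assms obtain d where d: "d > 0" "\<And>n (l :: nat \<Rightarrow> real) u.
        (\<forall>i<n. a \<le> l i \<and> l i \<le> u i \<and> u i \<le> b) \<Longrightarrow>
        disjoint_family_on (\<lambda>i. {l i<..<u i}) {..<n} \<Longrightarrow>
        (\<Sum>i<n. u i - l i) < d \<Longrightarrow> (\<Sum>i<n. dist (f (l i)) (f (u i))) < e"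
    unfolding abs_continuous_on_def by meson
  show ?thesis
  proof (intro exI[of _ d] conjI allI impI d(1))
    fix l u :: "'i \<Rightarrow> real" and p :: "'i set"
    assume fin: "finite p" and bd: "\<forall>i\<in>p. a \<le> l i \<and> l i \<le> u i \<and> u i \<le> b"
      and disj: "disjoint_family_on (\<lambda>i. {l i<..<u i}) p" and len: "(\<Sum>i\<in>p. u i - l i) < d"
    obtain h where h: "bij_betw h {..<card p} p"
      using ex_bij_betw_nat_finite[OF fin] by (auto simp: atLeast0LessThan)
    then have inj: "inj_on h {..<card p}" and hp: "\<And>k. k < card p \<Longrightarrow> h k \<in> p"
      by (auto simp: bij_betw_def)
    have "(\<Sum>k<card p. dist (f (l (h k))) (f (u (h k)))) < e"
    proof (rule d(2))
      show "\<forall>k<card p. a \<le> l (h k) \<and> l (h k) \<le> u (h k) \<and> u (h k) \<le> b"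
        using bd hp by blast
      show "disjoint_family_on (\<lambda>k. {l (h k)<..<u (h k)}) {..<card p}"
        unfolding disjoint_family_on_def
      proof (intro ballI impI)
        fix m n assume "m \<in> {..<card p}" "n \<in> {..<card p}" "m \<noteq> n"
        then have "h m \<noteq> h n" "h m \<in> p" "h n \<in> p"
          using inj hp by (auto simp: inj_on_def)
        then show "{l (h m)<..<u (h m)} \<inter> {l (h n)<..<u (h n)} = {}"
          using disj unfolding disjoint_family_on_def by blast
      qed
      show "(\<Sum>k<card p. u (h k) - l (h k)) < d"
        using len sum.reindex_bij_betw[OF h, of "\<lambda>i. u i - l i"] by simp
    qed
    then show "(\<Sum>i\<in>p. dist (f (l i)) (f (u i))) < e"
      using sum.reindex_bij_betw[OF h, of "\<lambda>i. dist (f (l i)) (f (u i))"] by simp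
  qed
qed

text \<open>By disjointness the total length is the measure of the union, which lies in
  \<open>T\<close>. The open intervals are those that absolute continuity speaks of.\<close>

lemma sum_length_disjoint_intervals_less:
  fixes l u :: "'i \<Rightarrow> real"
  assumes "finite p" "\<And>i. i \<in> p \<Longrightarrow> l i \<le> u i" "disjoint_family_on (\<lambda>i. {l i<..<u i}) p"
    and "\<And>i. i \<in> p \<Longrightarrow> {l i<..<u i} \<subseteq> T" "T \<in> sets lebesgue" "emeasure lebesgue T < ennreal d"
  shows "(\<Sum>i\<in>p. u i - l i) < d"
proof -
  have "ennreal (\<Sum>i\<in>p. u i - l i) = (\<Sum>i\<in>p. ennreal (u i - l i))"
    by (rule sum_ennreal[symmetric]) (use assms(2) in auto)
  also have "\<dots> = (\<Sum>i\<in>p. emeasure lebesgue {l i<..<u i})"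
    by (intro sum.cong) (use assms(2) in auto)
  also have "\<dots> = emeasure lebesgue (\<Union>i\<in>p. {l i<..<u i})"
    by (rule sum_emeasure) (use assms(1,3) in auto)
  also have "\<dots> \<le> emeasure lebesgue T"
    by (rule emeasure_mono) (use assms(4,5) in auto)
  also note assms(6)
  finally show ?thesis
    by (simp add: ennreal_less_iff sum_nonneg assms(2))
qed

text \<open>The proof works with the gauge integral. At tags outside \<open>E\<close>,
  differentiability makes the increment of \<open>f\<close> nearly linear on each small interval. At
  tags in \<open>E\<close>, the gauge confines the intervals to an open set of small measure, and
  absolute continuity makes the sum of their increments small. Each kind of tag costs at most
  e/2.\<close>

theorem fundamental_theorem_of_calculus_abs_continuous:
  fixes f :: "real \<Rightarrow> complex"
  assumes "a \<le> b" and ac: "abs_continuous_on a b f" and "negligible E"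
    and der: "\<And>x. x \<in> {a..b} - E \<Longrightarrow> (f has_vector_derivative f' x) (at x within {a..b})"
  shows "(f' has_integral f b - f a) {a..b}"
proof -
  \<comment> \<open>Setting the integrand to 0 on \<open>E\<close> removes the terms with tags in
    \<open>E\<close> from every Riemann sum; the integral does not change, as \<open>E\<close> is
    negligible.\<close>
  define g where "g x = (if x \<in> E then 0 else f' x)" for x
  have "(g has_integral f b - f a) (cbox a b)"
    unfolding has_integral
  proof (intro allI impI)
    fix e :: real assume "e > 0"
    \<comment> \<open>A slope error of \<open>e1\<close> over the total length b - a costs at most
      e/2; the summand 1 keeps the denominator positive when a = b.\<close>
    define e1 where "e1 = e / (2 * (b - a + 1))"
    have "e1 > 0" using \<open>e > 0\<close> \<open>a \<le> b\<close> by (simp add: e1_def)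
    have "e1 * (b - a) \<le> e / 2" using \<open>e > 0\<close> \<open>a \<le> b\<close> by (simp add: e1_def field_simps)
    obtain d where d: "0 < d"
      "\<forall>p (l :: real \<times> real set \<Rightarrow> real) u. finite p \<longrightarrow> (\<forall>i\<in>p. a \<le> l i \<and> l i \<le> u i \<and> u i \<le> b) \<longrightarrow>
        disjoint_family_on (\<lambda>i. {l i<..<u i}) p \<longrightarrow> (\<Sum>i\<in>p. u i - l i) < d \<longrightarrow>
        (\<Sum>i\<in>p. dist (f (l i)) (f (u i))) < e / 2"
      using abs_continuous_on_finite_family[OF ac half_gt_zero[OF \<open>e > 0\<close>]] by blast
    have E: "E \<in> sets lebesgue" "emeasure lebesgue E = 0"
      using \<open>negligible E\<close> by (auto simp: negligible_iff_null_sets)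
    \<comment> \<open>Outer regularity puts the null set \<open>E\<close> into an open set whose
      measure is below the \<open>d\<close> of absolute continuity.\<close>
    obtain T where T: "open T" "E \<subseteq> T" "(T - E) \<in> lmeasurable" "emeasure lebesgue (T - E) < ennreal d"
      using sets_lebesgue_outer_open[OF E(1) \<open>0 < d\<close>] by metis
    have "emeasure lebesgue T = emeasure lebesgue (T - E)"
      by (rule sym, rule emeasure_Diff_null_set) (use E T(1) in \<open>auto simp: null_sets_def\<close>)
    with T have emT: "emeasure lebesgue T < ennreal d" by simp
    \<comment> \<open>The radius of the gauge at \<open>x\<close>: outside \<open>E\<close> it comes
      from the derivative with error \<open>e1\<close>, inside \<open>E\<close> it keeps the ball
      within \<open>T\<close>.\<close>
    have "\<exists>r>0. (x \<in> {a..b} - E \<longrightarrow>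
         (\<forall>y\<in>{a..b}. norm (y-x) < r \<longrightarrow> norm (f y - f x - (y-x) *\<^sub>R f' x) \<le> e1 * norm (y-x)))
         \<and> (x \<in> E \<longrightarrow> ball x r \<subseteq> T)" for x
    proof (cases "x \<in> E")
      case True
      then show ?thesis using T(1,2) openE by blast
    next
      case False
      then show ?thesis
        using der[of x] \<open>e1 > 0\<close> unfolding has_vector_derivative_def has_derivative_within_alt
        by (cases "x \<in> {a..b}") (auto intro: exI[of _ 1])
    qed
    then obtain r where r: "\<And>x. r x > 0"
      "\<And>x y. \<lbrakk>x \<in> {a..b} - E; y \<in> {a..b}; norm (y-x) < r x\<rbrakk>
           \<Longrightarrow> norm (f y - f x - (y-x) *\<^sub>R f' x) \<le> e1 * norm (y-x)"
      "\<And>x. x \<in> E \<Longrightarrow> ball x (r x) \<subseteq> T"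
      by metis
    show "\<exists>\<gamma>. gauge \<gamma> \<and> (\<forall>\<D>. \<D> tagged_division_of (cbox a b) \<and> \<gamma> fine \<D> \<longrightarrow>
        norm ((\<Sum>(x, k)\<in>\<D>. measure lborel k *\<^sub>R g x) - (f b - f a)) < e)"
    proof (intro exI[of _ "\<lambda>x. ball x (r x)"] conjI allI impI; (elim conjE)?)
      show "gauge (\<lambda>x. ball x (r x))"
        using r(1) gauge_ball_dependent by blast
      fix p
      assume ptag: "p tagged_division_of cbox a b" and fine: "(\<lambda>x. ball x (r x)) fine p"
      have "finite p" using ptag by blast
      have tag: "Inf K \<le> Sup K \<and> K = {Inf K..Sup K} \<and> x \<in> K \<and> a \<le> Inf K \<and> Sup K \<le> b
          \<and> {Inf K..Sup K} \<subseteq> ball x (r x) \<and> measure lborel K = Sup K - Inf K"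
        if xK: "(x, K) \<in> p" for x K
      proof -
        have "x \<in> K" "K \<subseteq> {a..b}" "K \<subseteq> ball x (r x)"
          using ptag xK fine by (auto dest: fineD)
        moreover obtain u v where K: "K = cbox u v" using ptag xK by blast
        moreover have "u \<le> v" using \<open>x \<in> K\<close> K by auto
        ultimately show ?thesis by auto
      qed
      \<comment> \<open>The error of one tagged interval. Since increments of \<open>f\<close>
        telescope over a division, these errors sum to the Riemann sum minus f b - f a.\<close>
      define D where "D = (\<lambda>(x, K). measure lborel K *\<^sub>R g x - (f (Sup K) - f (Inf K)))"
      define pE where "pE = {z \<in> p. fst z \<in> E}"
      have pp: "pE \<subseteq> p" "finite pE" using \<open>finite p\<close> by (auto simp: pE_def)
      have "norm (\<Sum>z\<in>p - pE. D z) \<le> (\<Sum>z\<in>p - pE. e1 * (Sup (snd z) - Inf (snd z)))"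
      proof (rule sum_norm_le, clarify)
        fix x K assume xK: "(x, K) \<in> p" "(x, K) \<notin> pE"
        define u v where "u = Inf K" and "v = Sup K"
        have K: "u \<le> v" "K = {u..v}" "u \<le> x" "x \<le> v" "a \<le> u" "v \<le> b" "measure lborel K = v - u"
            "u \<in> ball x (r x)" "v \<in> ball x (r x)" "x \<notin> E"
          using tag[OF xK(1)] xK subsetD[of "{u..v}" "ball x (r x)"]
          by (auto simp: pE_def simp flip: u_def v_def)
        \<comment> \<open>Both endpoints are compared with the tag \<open>x\<close>. As
          \<open>x\<close> lies between \<open>u\<close> and \<open>v\<close>, the two distances add
          up to v - u, so the errors stay proportional to the length.\<close>
        have "norm ((v - u) *\<^sub>R f' x - (f v - f u))
            = norm (f u - f x - (u - x) *\<^sub>R f' x - (f v - f x - (v - x) *\<^sub>R f' x))"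
          by (auto simp: algebra_simps)
        also have "\<dots> \<le> norm (f u - f x - (u - x) *\<^sub>R f' x) + norm (f v - f x - (v - x) *\<^sub>R f' x)"
          by (rule norm_triangle_ineq4)
        also have "\<dots> \<le> e1 * norm (u - x) + e1 * norm (v - x)"
          by (intro add_mono r(2)) (use K in \<open>auto simp: dist_norm norm_minus_commute\<close>)
        also have "\<dots> = e1 * (v - u)"
          using K by (simp add: algebra_simps)
        finally show "norm (D (x, K)) \<le> e1 * (Sup (snd (x, K)) - Inf (snd (x, K)))"
          using K by (simp add: D_def g_def flip: u_def v_def)
      qed
      also have "\<dots> \<le> (\<Sum>z\<in>p. e1 * (Sup (snd z) - Inf (snd z)))"
        by (rule sum_mono2) (use \<open>finite p\<close> tag \<open>e1 > 0\<close> in auto)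
      also have "\<dots> = e1 * (b - a)"
        using additive_tagged_division_1[where f = "\<lambda>x. x", OF \<open>a \<le> b\<close>] ptag
        by (simp add: sum_distrib_left[symmetric] case_prod_unfold)
      also have "\<dots> \<le> e / 2" by fact
      finally have 1: "norm (\<Sum>z\<in>p - pE. D z) \<le> e / 2" .
      \<comment> \<open>Here \<open>g\<close> vanishes at the tag, so only the increment of
        \<open>f\<close> remains.\<close>
      have "norm (\<Sum>z\<in>pE. D z) \<le> (\<Sum>z\<in>pE. dist (f (Inf (snd z))) (f (Sup (snd z))))"
        by (rule sum_norm_le) (auto simp: D_def g_def pE_def dist_norm norm_minus_commute)
      also have "\<dots> < e / 2"
      proof (rule d(2)[rule_format, OF \<open>finite pE\<close>])
        show disj: "disjoint_family_on (\<lambda>z. {Inf (snd z)<..<Sup (snd z)}) pE"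
          unfolding disjoint_family_on_def
        proof (intro ballI impI)
          fix z w assume *: "z \<in> pE" "w \<in> pE" "z \<noteq> w"
          obtain x K y L where zw: "z = (x, K)" "w = (y, L)" by (metis surj_pair)
          with * have KL: "(x, K) \<in> p" "(y, L) \<in> p" "(x, K) \<noteq> (y, L)" by (auto simp: pE_def)
          then have "interior K \<inter> interior L = {}"
            using ptag by blast
          moreover have "interior K = {Inf K<..<Sup K}"
            by (metis tag[OF KL(1)] interior_atLeastAtMost_real)
          moreover have "interior L = {Inf L<..<Sup L}"
            by (metis tag[OF KL(2)] interior_atLeastAtMost_real)
          ultimately show "{Inf (snd z)<..<Sup (snd z)} \<inter> {Inf (snd w)<..<Sup (snd w)} = {}"
            by (simp add: zw)
        qed
        show "(\<Sum>z\<in>pE. Sup (snd z) - Inf (snd z)) < d"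
        proof (rule sum_length_disjoint_intervals_less[OF \<open>finite pE\<close> _ disj _ _ emT])
          fix z assume z: "z \<in> pE"
          obtain x K where zz: "z = (x, K)" by force
          then have "(x, K) \<in> p" "x \<in> E" using z by (auto simp: pE_def)
          then show "{Inf (snd z)<..<Sup (snd z)} \<subseteq> T" "Inf (snd z) \<le> Sup (snd z)"
            using tag[of x K] r(3)[of x] zz greaterThanLessThan_subseteq_atLeastAtMost_iff by fastforce+
        qed (use T(1) in auto)
      qed (use tag pp in force)
      finally have 2: "norm (\<Sum>z\<in>pE. D z) < e / 2" .
      have "(\<Sum>(x, k)\<in>p. measure lborel k *\<^sub>R g x) - (f b - f a) = (\<Sum>z\<in>p. D z)"
        using additive_tagged_division_1[where f = f, OF \<open>a \<le> b\<close>] ptag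
        by (simp add: D_def case_prod_unfold sum_subtractf)
      also have "\<dots> = (\<Sum>z\<in>p - pE. D z) + (\<Sum>z\<in>pE. D z)"
        by (rule sum.subset_diff) (use pp \<open>finite p\<close> in auto)
      finally show "norm ((\<Sum>(x, k)\<in>p. measure lborel k *\<^sub>R g x) - (f b - f a)) < e"
        using 1 2 norm_triangle_ineq[of "\<Sum>z\<in>p - pE. D z" "\<Sum>z\<in>pE. D z"] by simp
    qed
  qed
  then show ?thesis
    by (intro has_integral_spike[OF \<open>negligible E\<close>, of _ f' g]) (auto simp: g_def)
qed

section \<open>Interchanging the order of integration\<close>

lemma lebesgue_integral_on_indicator:
  fixes f :: "real \<Rightarrow> 'a :: euclidean_space"
  assumes "A \<in> sets lebesgue" "B \<in> sets lebesgue" "A \<subseteq> B"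
  shows "(LINT x|lebesgue_on B. (if x \<in> A then f x else 0)) = (LINT x|lebesgue_on A. f x)"
proof -
  have "indicat_real B x *\<^sub>R (if x \<in> A then f x else 0) = indicat_real A x *\<^sub>R f x" for x
    using assms(3) by (auto simp: indicator_def)
  then show ?thesis
    using assms by (simp add: integral_restrict_space)
qed

lemma sigma_finite_lebesgue_on_interval: "sigma_finite_measure (lebesgue_on {a..b::real})"
  by (intro finite_measure.axioms finite_measure_lebesgue_on) simp

text \<open>Both sides are iterated integrals of g(t) \<rho>(x) over the triangle t \<le> x:
  integrating over t first produces the primitive of \<open>g\<close>, integrating over x first
  leaves the integral of \<open>\<rho>\<close> from t to b.\<close>

lemma integral_primitive_mult:
  fixes g \<rho> :: "real \<Rightarrow> complex"
  assumes g: "integrable (lebesgue_on {a..b}) g" and \<rho>: "integrable (lebesgue_on {a..b}) \<rho>"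
  shows "(LINT x|lebesgue_on {a..b}. primitive a g x * \<rho> x)
       = (LINT t|lebesgue_on {a..b}. g t * (primitive a \<rho> b - primitive a \<rho> t))"
proof -
  define M where "M = lebesgue_on {a..b}"
  interpret sigma_finite_measure M
    unfolding M_def by (rule sigma_finite_lebesgue_on_interval)
  interpret pair_sigma_finite M M ..
  have [measurable]: "g \<in> borel_measurable M" "\<rho> \<in> borel_measurable M"
    using g \<rho> by (auto simp: M_def)
  \<comment> \<open>Makes the triangle t \<le> x measurable in the product space.\<close>
  have [measurable]: "(\<lambda>x. x) \<in> borel_measurable M"
    using id_borel_measurable_lebesgue_on by (simp add: M_def id_def)
  have gM: "integrable M g" and \<rho>M: "integrable M \<rho>"
    using g \<rho> by (auto simp: M_def)
  \<comment> \<open>The product without truncation is integrable and dominates the kernel cut off to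
    the triangle.\<close>
  have prod: "integrable (M \<Otimes>\<^sub>M M) (\<lambda>z. g (fst z) * \<rho> (snd z))"
  proof (rule Fubini_integrable)
    show "integrable M (\<lambda>x. LINT y|M. norm (g (fst (x, y)) * \<rho> (snd (x, y))))"
      using gM \<rho>M by (simp add: norm_mult)
  qed (use \<rho>M in simp_all)
  have int: "integrable (M \<Otimes>\<^sub>M M) (\<lambda>(t, x). if t \<le> x then g t * \<rho> x else 0)"
  proof (rule Bochner_Integration.integrable_bound[OF prod])
    show "(\<lambda>(t, x). if t \<le> x then g t * \<rho> x else 0) \<in> borel_measurable (M \<Otimes>\<^sub>M M)"
      by measurable
  qed auto
  have 1: "(LINT t|M. (if t \<le> x then g t * \<rho> x else 0)) = primitive a g x * \<rho> x"
    if "x \<in> space M" for x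
  proof -
    have "(LINT t|M. (if t \<le> x then g t * \<rho> x else 0)) = (LINT t|M. (if t \<in> {a..x} then g t * \<rho> x else 0))"
      by (rule Bochner_Integration.integral_cong) (auto simp: M_def)
    also have "\<dots> = (LINT t|lebesgue_on {a..x}. g t * \<rho> x)"
      unfolding M_def by (rule lebesgue_integral_on_indicator) (use that in \<open>auto simp: M_def\<close>)
    finally show ?thesis by (simp add: primitive_def)
  qed
  have 2: "(LINT x|M. (if t \<le> x then g t * \<rho> x else 0)) = g t * (primitive a \<rho> b - primitive a \<rho> t)"
    if "t \<in> space M" for t
  proof -
    have t: "a \<le> t" "t \<le> b" using that by (auto simp: M_def)
    have "(LINT x|M. (if t \<le> x then g t * \<rho> x else 0)) = (LINT x|M. (if x \<in> {t..b} then g t * \<rho> x else 0))"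
      by (rule Bochner_Integration.integral_cong) (auto simp: M_def)
    also have "\<dots> = (LINT x|lebesgue_on {t..b}. g t * \<rho> x)"
      unfolding M_def by (rule lebesgue_integral_on_indicator) (use t in auto)
    finally show ?thesis
      using Equivalence_Measurable_On_Borel.integral_combine[OF \<rho> t] by (simp add: primitive_def)
  qed
  have "(LINT x|M. primitive a g x * \<rho> x) = (LINT x|M. LINT t|M. (if t \<le> x then g t * \<rho> x else 0))"
    by (rule Bochner_Integration.integral_cong) (auto simp: 1)
  also have "\<dots> = (LINT t|M. LINT x|M. (if t \<le> x then g t * \<rho> x else 0))"
    by (rule Fubini_integral[OF int])
  also have "\<dots> = (LINT t|M. g t * (primitive a \<rho> b - primitive a \<rho> t))"
    by (rule Bochner_Integration.integral_cong) (auto simp: 2)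
  finally show ?thesis unfolding M_def .
qed

section \<open>Square-integrable functions and the Cauchy-Schwarz inequality\<close>

lemma L2_integrable_mult:
  assumes "g \<in> L2 a b" "h \<in> L2 a b"
  shows "integrable (lebesgue_on {a..b}) (\<lambda>x. g x * h x)"
proof (rule Bochner_Integration.integrable_bound)
  show "integrable (lebesgue_on {a..b}) (\<lambda>x. (cmod (g x))\<^sup>2 + (cmod (h x))\<^sup>2)"
    using assms by (auto simp: L2_def)
  have "norm (g x * h x) \<le> (cmod (g x))\<^sup>2 + (cmod (h x))\<^sup>2" for x
    using sum_squares_bound[of "cmod (g x)" "cmod (h x)"] mult_nonneg_nonneg[of "cmod (g x)" "cmod (h x)"]
      norm_ge_zero[of "g x"] norm_ge_zero[of "h x"]
    unfolding norm_mult by linarith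
  then show "AE x in lebesgue_on {a..b}. norm (g x * h x) \<le> norm ((cmod (g x))\<^sup>2 + (cmod (h x))\<^sup>2)"
    by simp
qed (use assms in \<open>auto simp: L2_def\<close>)

lemma continuous_imp_L2:
  assumes "continuous_on {a..b} g"
  shows "g \<in> L2 a b"
  unfolding L2_def
proof (intro CollectI conjI)
  show "g \<in> borel_measurable (lebesgue_on {a..b})"
    by (intro borel_measurable_integrable continuous_imp_integrable_real assms)
  show "integrable (lebesgue_on {a..b}) (\<lambda>x. (cmod (g x))\<^sup>2)"
    by (intro continuous_imp_integrable_real continuous_intros assms)
qed

text \<open>The interval is bounded, so the constant 1 is itself square integrable and can serve as
  the second factor.\<close>

lemma L2_integrable:
  assumes "g \<in> L2 a b"
  shows "integrable (lebesgue_on {a..b}) g"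
  using L2_integrable_mult[OF assms continuous_imp_L2[of a b "\<lambda>_. 1"]] by simp

lemma L2_norm_nonneg: "0 \<le> L2_norm a b g"
  by (simp add: L2_norm_def)

lemma L2_norm_power2: "(L2_norm a b g)\<^sup>2 = (LINT x|lebesgue_on {a..b}. (cmod (g x))\<^sup>2)"
  by (simp add: L2_norm_def)

text \<open>The integral of (r |g| + |h|)^2 is a nonnegative quadratic in the real number r, which
  bounds its middle coefficient. Taking absolute values first avoids complex phases and
  conjugates.\<close>

lemma L2_Cauchy_Schwarz:
  assumes g: "g \<in> L2 a b" and h: "h \<in> L2 a b"
  shows "cmod (LINT x|lebesgue_on {a..b}. g x * h x) \<le> L2_norm a b g * L2_norm a b h"
proof -
  define A B I where "A = (L2_norm a b g)\<^sup>2" and "B = (L2_norm a b h)\<^sup>2"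
    and "I = (LINT x|lebesgue_on {a..b}. cmod (g x * h x))"
  have int: "integrable (lebesgue_on {a..b}) (\<lambda>x. cmod (g x * h x))"
     "integrable (lebesgue_on {a..b}) (\<lambda>x. (cmod (g x))\<^sup>2)" "integrable (lebesgue_on {a..b}) (\<lambda>x. (cmod (h x))\<^sup>2)"
    using L2_integrable_mult[OF g h] g h by (auto simp: L2_def)
  have quad: "0 \<le> r\<^sup>2 * A + 2 * r * I + B" for r
  proof -
    have "0 \<le> (LINT x|lebesgue_on {a..b}. (r * cmod (g x) + cmod (h x))\<^sup>2)"
      by simp
    also have "\<dots> = (LINT x|lebesgue_on {a..b}. r\<^sup>2 * (cmod (g x))\<^sup>2 + 2 * r * cmod (g x * h x) + (cmod (h x))\<^sup>2)"
      by (simp add: power2_eq_square algebra_simps norm_mult)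
    also have "\<dots> = r\<^sup>2 * A + 2 * r * I + B"
      using int by (simp add: A_def B_def I_def L2_norm_power2)
    finally show ?thesis .
  qed
  have "A \<ge> 0" "I \<ge> 0" by (simp_all add: A_def I_def)
  have "I\<^sup>2 \<le> A * B"
  proof (cases "A = 0")
    case True
    have "I = 0"
    proof (rule ccontr)
      assume "I \<noteq> 0"
      then show False
        \<comment> \<open>With A = 0 the quadratic is affine in r, and this r gives it the value
          -1.\<close>
        using quad[of "- (B + 1) / (2 * I)"] True by (simp add: field_simps)
    qed
    then show ?thesis using True by simp
  next
    case False
    then show ?thesis
      \<comment> \<open>The minimum of the quadratic, where its value is B - I^2 / A.\<close>
      using quad[of "- I / A"] \<open>A \<ge> 0\<close> by (simp add: field_simps power2_eq_square)
  qed
  then have "I \<le> L2_norm a b g * L2_norm a b h"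
    using power2_le_imp_le[of I "L2_norm a b g * L2_norm a b h"]
      mult_nonneg_nonneg[OF L2_norm_nonneg L2_norm_nonneg]
    by (simp add: A_def B_def power_mult_distrib)
  moreover have "cmod (LINT x|lebesgue_on {a..b}. g x * h x) \<le> I"
    unfolding I_def by (rule integral_norm_bound)
  ultimately show ?thesis by linarith
qed

lemma L2_norm_divide:
  "L2_norm a b (\<lambda>x. g x / complex_of_real r) = L2_norm a b g / \<bar>r\<bar>"
  by (simp add: L2_norm_def norm_divide power_divide real_sqrt_divide)

section \<open>Functions in \<open>H10\<close> as primitives of their derivatives\<close>

text \<open>The points of non-differentiability lie in a negligible set, so the fundamental theorem
  applies on {a..x}, and f a = 0 removes the constant.\<close>

lemma H10_eq_primitive:
  assumes f: "f \<in> H10 a b" and x: "x \<in> {a..b}"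
  shows "f x = primitive a (derivative_on a b f) x"
proof -
  define D where "D = derivative_on a b f"
  have ac: "abs_continuous_on a b f" and "f a = 0"
    and diff: "AE x in lebesgue_on {a..b}. f differentiable (at x within {a..b})"
    using f by (auto simp: H10_def)
  have "integrable (lebesgue_on {a..b}) D"
    unfolding D_def using f by (intro L2_integrable) (simp add: H10_def)
  then have D: "integrable (lebesgue_on {a..x}) D"
    by (rule integrable_subinterval) (use x in auto)
  from diff have "AE x in lebesgue. x \<in> {a..b} \<longrightarrow> f differentiable (at x within {a..b})"
    by (subst (asm) AE_restrict_space_iff) auto
  then obtain E where E: "negligible E"
    "{x. \<not> (x \<in> {a..b} \<longrightarrow> f differentiable (at x within {a..b}))} \<subseteq> E"
    unfolding eventually_ae_filter_negligible by auto
  have "(D has_integral f x - f a) {a..x}"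
  proof (rule fundamental_theorem_of_calculus_abs_continuous[OF _ _ E(1)])
    fix y assume y: "y \<in> {a..x} - E"
    then have "f differentiable (at y within {a..b})" using E(2) x by auto
    then have "(f has_vector_derivative D y) (at y within {a..b})"
      unfolding D_def derivative_on_def by (simp add: vector_derivative_works)
    then show "(f has_vector_derivative D y) (at y within {a..x})"
      by (rule has_vector_derivative_within_subset) (use x in auto)
  qed (use x abs_continuous_on_subinterval[OF ac, of a x] in auto)
  then have "f x = integral {a..x} D"
    using \<open>f a = 0\<close> by (simp add: integral_unique)
  \<comment> \<open>The fundamental theorem gives a gauge integral; it is a Lebesgue integral
    because \<open>D\<close>, being square integrable, is integrable.\<close>
  also have "\<dots> = primitive a D x"
    unfolding primitive_def by (rule lebesgue_integral_eq_integral[symmetric]) (use D in auto)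
  finally show ?thesis unfolding D_def .
qed

lemma continuous_on_primitive:
  assumes "integrable (lebesgue_on {a..b}) \<rho>"
  shows "continuous_on {a..b} (primitive a \<rho>)"
  using indefinite_integral_continuous_real[OF assms] by (simp add: primitive_def[abs_def])

text \<open>The constant \<open>c\<close> is free: f a = f b = 0 means that the derivative has
  integral zero, so the endpoint value \<open>primitive a \<rho> b\<close> produced by Fubini may be
  traded for any constant.\<close>

lemma density_integral_H10:
  assumes "a < b" and f: "f \<in> H10 a b" and \<rho>: "integrable (lebesgue_on {a..b}) \<rho>"
  shows "density_integral a b \<rho> f
       = - (LINT t|lebesgue_on {a..b}. derivative_on a b f t * (primitive a \<rho> t - c))"
proof -
  define D where "D = derivative_on a b f"
  have D: "D \<in> L2 a b" using f by (simp add: H10_def D_def)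
  have DR: "integrable (lebesgue_on {a..b}) (\<lambda>t. D t * (primitive a \<rho> t - c))"
    by (intro L2_integrable_mult D continuous_imp_L2 continuous_intros continuous_on_primitive \<rho>)
  have D0: "(LINT t|lebesgue_on {a..b}. D t) = 0"
    using H10_eq_primitive[OF f, of b] f \<open>a < b\<close> by (simp add: H10_def D_def primitive_def)
  have "density_integral a b \<rho> f = (LINT x|lebesgue_on {a..b}. primitive a D x * \<rho> x)"
    unfolding density_integral_def D_def
    by (rule Bochner_Integration.integral_cong) (auto simp: H10_eq_primitive[OF f])
  also have "\<dots> = (LINT t|lebesgue_on {a..b}. D t * (primitive a \<rho> b - primitive a \<rho> t))"
    by (rule integral_primitive_mult[OF L2_integrable[OF D] \<rho>])
  also have "\<dots> = (LINT t|lebesgue_on {a..b}. D t * (primitive a \<rho> b - c) - D t * (primitive a \<rho> t - c))"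
    by (simp add: algebra_simps)
  also have "\<dots> = - (LINT t|lebesgue_on {a..b}. D t * (primitive a \<rho> t - c))"
    using DR D0 L2_integrable[OF D] by simp
  finally show ?thesis unfolding D_def .
qed

section \<open>Continuously differentiable functions in \<open>H10\<close>\<close>

lemma primitive_has_vector_derivative:
  assumes g: "continuous_on {a..b} g" and "t \<in> {a..b}"
  shows "(primitive a g has_vector_derivative g t) (at t within {a..b})"
proof (rule has_vector_derivative_transform[OF \<open>t \<in> {a..b}\<close>])
  show "((\<lambda>u. integral {a..u} g) has_vector_derivative g t) (at t within {a..b})"
    by (rule integral_has_vector_derivative) fact+
  fix x assume "x \<in> {a..b}"
  then have "continuous_on {a..x} g"
    by (intro continuous_on_subset[OF g]) auto
  then show "primitive a g x = integral {a..x} g"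
    unfolding primitive_def by (intro lebesgue_integral_eq_integral continuous_imp_integrable_real) auto
qed

lemma lipschitz_imp_abs_continuous_on:
  fixes f :: "real \<Rightarrow> complex"
  assumes "C-lipschitz_on {a..b} f"
  shows "abs_continuous_on a b f"
  unfolding abs_continuous_on_def
proof (intro allI impI)
  fix e :: real assume "e > 0"
  have "C \<ge> 0" using assms lipschitz_on_nonneg by blast
  show "\<exists>\<delta>>0. \<forall>n (l :: nat \<Rightarrow> real) u.
        (\<forall>i<n. a \<le> l i \<and> l i \<le> u i \<and> u i \<le> b) \<longrightarrow>
        disjoint_family_on (\<lambda>i. {l i<..<u i}) {..<n} \<longrightarrow>
        (\<Sum>i<n. u i - l i) < \<delta> \<longrightarrow> (\<Sum>i<n. dist (f (l i)) (f (u i))) < e"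
  \<comment> \<open>C + 1 in place of \<open>C\<close> covers the Lipschitz constant 0.\<close>
  proof (intro exI[of _ "e / (C + 1)"] conjI allI impI)
    fix n and l u :: "nat \<Rightarrow> real"
    assume lu: "\<forall>i<n. a \<le> l i \<and> l i \<le> u i \<and> u i \<le> b" and s: "(\<Sum>i<n. u i - l i) < e / (C + 1)"
    have "(\<Sum>i<n. dist (f (l i)) (f (u i))) \<le> (\<Sum>i<n. (C + 1) * (u i - l i))"
    proof (rule sum_mono)
      fix i assume "i \<in> {..<n}"
      then have i: "a \<le> l i" "l i \<le> u i" "u i \<le> b" using lu by auto
      then have "dist (f (l i)) (f (u i)) \<le> C * dist (l i) (u i)"
        by (intro lipschitz_onD[OF assms]) auto
      also have "\<dots> \<le> (C + 1) * (u i - l i)"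
        using i by (simp add: dist_real_def algebra_simps)
      finally show "dist (f (l i)) (f (u i)) \<le> (C + 1) * (u i - l i)" .
    qed
    also have "\<dots> = (C + 1) * (\<Sum>i<n. u i - l i)" by (simp add: sum_distrib_left)
    also have "\<dots> < e" using s \<open>C \<ge> 0\<close> by (simp add: field_simps)
    finally show "(\<Sum>i<n. dist (f (l i)) (f (u i))) < e" .
  qed (use \<open>e > 0\<close> \<open>C \<ge> 0\<close> in simp)
qed

lemma C1_abs_continuous_on:
  fixes f :: "real \<Rightarrow> complex"
  assumes g: "continuous_on {a..b} g"
    and der: "\<And>t. t \<in> {a..b} \<Longrightarrow> (f has_vector_derivative g t) (at t within {a..b})"
  shows "abs_continuous_on a b f"
proof -
  have "bounded (g ` {a..b})"
    by (intro compact_imp_bounded compact_continuous_image g) simp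
  then obtain C where C: "C > 0" "\<And>t. t \<in> {a..b} \<Longrightarrow> norm (g t) \<le> C"
    unfolding bounded_pos by auto
  have "C-lipschitz_on {a..b} f"
  proof (rule bounded_derivative_imp_lipschitz)
    show "(f has_derivative (\<lambda>h. h *\<^sub>R g t)) (at t within {a..b})" if "t \<in> {a..b}" for t
      using der[OF that] by (simp add: has_vector_derivative_def)
    show "onorm (\<lambda>h. h *\<^sub>R g t) \<le> C" if "t \<in> {a..b}" for t
      by (rule onorm_le) (use C(2)[OF that] in \<open>simp add: mult.commute[of C] mult_left_mono\<close>)
  qed (use C in auto)
  then show ?thesis by (rule lipschitz_imp_abs_continuous_on)
qed

text \<open>This is how the extremal function, whose derivative is continuous, and the zero function
  are shown to belong to \<open>H10\<close>. A continuous derivative is bounded, which gives a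
  Lipschitz bound and thus absolute continuity.\<close>

lemma C1_H10:
  fixes f :: "real \<Rightarrow> complex"
  assumes "a < b" and g: "continuous_on {a..b} g"
    and der: "\<And>t. t \<in> {a..b} \<Longrightarrow> (f has_vector_derivative g t) (at t within {a..b})"
    and "f a = 0" "f b = 0"
  shows "f \<in> H10 a b" and "\<And>t. t \<in> {a..b} \<Longrightarrow> derivative_on a b f t = g t"
proof -
  show eq: "derivative_on a b f t = g t" if "t \<in> {a..b}" for t
    unfolding derivative_on_def
    by (rule vector_derivative_within_closed_interval[OF \<open>a < b\<close> that der[OF that]])
  have "derivative_on a b f \<in> L2 a b"
    by (intro continuous_imp_L2 continuous_on_eq[OF g]) (simp add: eq)
  moreover have "AE t in lebesgue_on {a..b}. f differentiable (at t within {a..b})"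
    by (rule AE_I2) (use der in \<open>auto intro: differentiableI_vector\<close>)
  ultimately show "f \<in> H10 a b"
    using assms C1_abs_continuous_on[OF g der] by (simp add: H10_def)
qed

section \<open>The extremal function and the value of the supremum\<close>

lemma integral_minus_mean_value:
  assumes "a < b" and "integrable (lebesgue_on {a..b}) g"
  shows "(LINT x|lebesgue_on {a..b}. g x - mean_value a b g) = 0"
proof -
  have "measure (lebesgue_on {a..b}) {a..b} = b - a"
    using \<open>a < b\<close> by (simp add: measure_restrict_space)
  then show ?thesis
    using assms by (simp add: mean_value_def scaleR_conv_of_real flip: of_real_diff)
qed

text \<open>The claims about \<open>fstar\<close> are made for \<open>N\<close> nonzero: for N = 0
  division by zero yields 0, so \<open>fstar\<close> is the zero function and cannot have norm 1.
  The value of the supremum holds in both cases.\<close>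

theorem proposition2:
  fixes a b :: real and \<rho> R fstar :: "real \<Rightarrow> complex" and c :: complex and N :: real
  assumes "a < b"
    and "integrable (lebesgue_on {a..b}) \<rho>"
    and "R = primitive a \<rho>"
    and "c = mean_value a b R"
    and "N = L2_norm a b (\<lambda>t. R t - c)"
    and "fstar = (\<lambda>t. - primitive a (\<lambda>x. (cnj (R x) - cnj c) / complex_of_real N) t)"
  shows "initial_error a b \<rho> = ereal N \<and>
    (N \<noteq> 0 \<longrightarrow>
       fstar \<in> H10 a b \<and> density_integral a b \<rho> fstar = complex_of_real N \<and>
       H10_norm a b fstar = 1 \<and> fstar a = 0 \<and> fstar b = 0)"
proof -
  have contR: "continuous_on {a..b} R"
    unfolding assms(3) by (rule continuous_on_primitive) fact
  have RL2: "(\<lambda>t. R t - c) \<in> L2 a b"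
    by (intro continuous_imp_L2 continuous_intros contR)
  have "N \<ge> 0"
    by (simp add: assms(5) L2_norm_nonneg)
  have upper: "cmod (density_integral a b \<rho> f) \<le> N" if f: "f \<in> H10 a b" "H10_norm a b f \<le> 1" for f
  proof -
    have "derivative_on a b f \<in> L2 a b" using f by (simp add: H10_def)
    then have "cmod (density_integral a b \<rho> f) \<le> H10_norm a b f * N"
      using L2_Cauchy_Schwarz[OF _ RL2]
      by (simp add: density_integral_H10[OF assms(1) f(1) assms(2), of c] H10_norm_def assms(3,5))
    also have "\<dots> \<le> N"
      using mult_right_mono[OF f(2) \<open>N \<ge> 0\<close>] by simp
    finally show ?thesis .
  qed
  have extremal: "fstar \<in> H10 a b \<and> density_integral a b \<rho> fstar = complex_of_real N \<and>
       H10_norm a b fstar = 1 \<and> fstar a = 0 \<and> fstar b = 0" if "N \<noteq> 0"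
  proof -
    define G where "G = (\<lambda>x. (cnj (R x) - cnj c) / complex_of_real N)"
    have G: "continuous_on {a..b} G"
      unfolding G_def using \<open>N \<noteq> 0\<close> by (intro continuous_intros contR) auto
    have fstar: "fstar = (\<lambda>t. - primitive a G t)"
      by (simp add: assms(6) G_def)
    have fa: "fstar a = 0"
      using lebesgue_integral_eq_integral[OF continuous_imp_integrable_real[of a a G]]
      by (simp add: fstar primitive_def)
    \<comment> \<open>Conjugation commutes with the integral, so \<open>G\<close> inherits mean zero
      from R - c; this is what makes \<open>fstar\<close> vanish at b.\<close>
    have "(LINT x|lebesgue_on {a..b}. G x) = cnj (LINT x|lebesgue_on {a..b}. R x - c) / N"
      by (simp add: G_def flip: integral_cnj complex_cnj_diff)
    then have fb: "fstar b = 0"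
      using integral_minus_mean_value[OF assms(1) continuous_imp_integrable_real[OF contR]]
      by (simp add: fstar primitive_def assms(4))
    have der: "(fstar has_vector_derivative - G t) (at t within {a..b})" if "t \<in> {a..b}" for t
      unfolding fstar by (intro has_vector_derivative_minus primitive_has_vector_derivative G that)
    have mem: "fstar \<in> H10 a b"
      by (rule C1_H10(1)[OF assms(1) continuous_on_minus[OF G] der fa fb])
    have deriv: "derivative_on a b fstar t = - G t" if "t \<in> {a..b}" for t
      by (rule C1_H10(2)[OF assms(1) continuous_on_minus[OF G] der fa fb that])
    have "H10_norm a b fstar = L2_norm a b (\<lambda>t. (R t - c) / complex_of_real N)"
      unfolding H10_norm_def L2_norm_def
      by (intro arg_cong[of _ _ sqrt] Bochner_Integration.integral_cong)
        (auto simp: deriv G_def norm_divide simp flip: complex_cnj_diff)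
    also have "\<dots> = 1"
      using \<open>N \<noteq> 0\<close> \<open>N \<ge> 0\<close> by (simp add: L2_norm_divide flip: assms(5))
    finally have norm1: "H10_norm a b fstar = 1" .
    have "density_integral a b \<rho> fstar
        = - (LINT t|lebesgue_on {a..b}. derivative_on a b fstar t * (R t - c))"
      by (simp add: density_integral_H10[OF assms(1) mem assms(2), of c] assms(3))
    \<comment> \<open>The derivative of \<open>fstar\<close> is -\<open>G\<close>, a negative
      multiple of the conjugate of R - c, so the integrand becomes real and the two minus signs
      cancel.\<close>
    also have "\<dots> = - (LINT t|lebesgue_on {a..b}. complex_of_real (- (cmod (R t - c))\<^sup>2 / N))"
    proof (intro arg_cong[of _ _ uminus] Bochner_Integration.integral_cong refl)
      fix t assume "t \<in> space (lebesgue_on {a..b})"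
      then show "derivative_on a b fstar t * (R t - c) = complex_of_real (- (cmod (R t - c))\<^sup>2 / N)"
        using complex_norm_square[of "R t - c"] by (simp add: deriv G_def mult.commute)
    qed
    also have "\<dots> = complex_of_real (N\<^sup>2 / N)"
      unfolding integral_complex_of_real by (simp add: assms(5) L2_norm_power2)
    also have "\<dots> = complex_of_real N"
      using \<open>N \<noteq> 0\<close> by (simp add: power2_eq_square)
    finally show ?thesis using mem norm1 fa fb by blast
  qed
  have "initial_error a b \<rho> = ereal N"
    unfolding initial_error_def
  proof (rule antisym)
    show "(SUP f \<in> {f \<in> H10 a b. H10_norm a b f \<le> 1}. ereal (cmod (density_integral a b \<rho> f))) \<le> ereal N"
      by (rule SUP_least) (use upper in auto)
    \<comment> \<open>The bound \<open>N\<close> is attained: by the zero function if N = 0,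
      otherwise by \<open>fstar\<close>.\<close>
    obtain f where "f \<in> H10 a b" "H10_norm a b f \<le> 1" "cmod (density_integral a b \<rho> f) = N"
    proof (cases "N = 0")
      case True
      note zero = C1_H10[OF assms(1), of "\<lambda>_. 0" "\<lambda>_. 0", simplified]
      have "L2_norm a b (derivative_on a b (\<lambda>_. 0)) = L2_norm a b (\<lambda>_. 0)"
        unfolding L2_norm_def
        by (intro arg_cong[of _ _ sqrt] Bochner_Integration.integral_cong) (simp_all add: zero)
      then have z: "(\<lambda>_. 0) \<in> H10 a b" "H10_norm a b (\<lambda>_. 0) \<le> 1"
        by (simp_all add: zero H10_norm_def L2_norm_def)
      show thesis
        by (rule that[OF z]) (simp add: True density_integral_def)
    next
      case False
      with extremal \<open>N \<ge> 0\<close> show thesis by (intro that[of fstar]) auto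
    qed
    then show "ereal N \<le> (SUP f \<in> {f \<in> H10 a b. H10_norm a b f \<le> 1}. ereal (cmod (density_integral a b \<rho> f)))"
      by (intro SUP_upper2[of f]) auto
  qed
  with extremal show ?thesis by blast
qed

end
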